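(* Let $A$ be a complex $n\times n$ matrix. If the geometric multiplicity of every eigenvalue $\lambda$ of $A$ (the number of Jordan blocks of $A$ with eigenvalue $\lambda$) is $1$, then for any multiset $M$ of complex numbers of size $n$ there is a rank $1$ matrix $B\in\mathbb{C}^{n\times n}$ such that $\operatorname{sp}(A+B)=M$.
   Context: $\mathbb{C}^{n\times n}$ denotes the set of all complex $n\times n$ matrices. $\operatorname{sp}(A)$ denotes the spectrum of $A$ as a multiset of complex numbers, each eigenvalue counted with its algebraic multiplicity. The size of a multiset is counted with multiplicity.
   Formalization: It is assumed that n ≥ 1, and that M ≠ sp(A) when n = 1: for n = 0 no rank 1 matrix exists, and for n = 1, M = sp(A) only B = 0 gives sp(A+B) = M, so the claim with rank exactly 1 fails in those cases. *)

theory Defs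
  imports
    "Jordan_Normal_Form.Jordan_Normal_Form_Existence"
    "Jordan_Normal_Form.Jordan_Normal_Form_Uniqueness"
    "Jordan_Normal_Form.DL_Rank"
    "HOL-Computational_Algebra.Fundamental_Theorem_Algebra"
begin

text \<open>The algebraic multiplicity of an eigenvalue is its order as a root of the
  characteristic polynomial.\<close>

definition sp :: "complex mat \<Rightarrow> complex multiset" where
  "sp A = proots (char_poly A)"

lemma count_sp:
  assumes "A \<in> carrier_mat n n"
  shows "count (sp A) ev = Polynomial.order ev (char_poly A)"
proof -
  have "char_poly A \<noteq> 0"
    using degree_monic_char_poly[OF assms] by auto
  then show ?thesis by (simp add: sp_def)
qed

lemma set_mset_sp:
  assumes "A \<in> carrier_mat n n"
  shows "set_mset (sp A) = {ev. eigenvalue A ev}"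
proof -
  have "char_poly A \<noteq> 0"
    using degree_monic_char_poly[OF assms] by auto
  then show ?thesis by (simp add: sp_def eigenvalue_root_char_poly[OF assms])
qed

lemma size_sp:
  assumes "A \<in> carrier_mat n n"
  shows "size (sp A) = n"
  using degree_monic_char_poly[OF assms] by (simp add: sp_def size_proots_complex)

text \<open>In a Jordan normal form \<open>n_as\<close> each pair \<open>(k, a)\<close> is one Jordan block of size \<open>k\<close>
  with eigenvalue \<open>a\<close>. The form is unique only up to the order of its blocks; the lemmas
  below show that the count does not depend on the choice and that it is the dimension of
  the eigenspace.\<close>

definition geometric_multiplicity :: "complex mat \<Rightarrow> complex \<Rightarrow> nat" where
  "geometric_multiplicity A ev =
     length [(k, a) \<leftarrow> (SOME n_as. jordan_nf A n_as). a = ev]"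

lemma complex_jordan_nf_exists:
  fixes A :: "complex mat"
  assumes "A \<in> carrier_mat n n"
  shows "\<exists>n_as. jordan_nf A n_as"
  using char_poly_factorized[OF assms] jordan_nf_exists[OF assms] by blast

lemma length_jordan_blocks:
  assumes "jordan_nf A n_as"
  shows "length [(k, a) \<leftarrow> n_as. a = ev] = dim_gen_eigenspace A ev 1"
proof -
  have "0 \<notin> fst ` set n_as"
    using assms by (simp add: jordan_nf_def)
  then have "length [(k, a) \<leftarrow> n_as. a = ev]
      = (\<Sum>n\<leftarrow>map fst [(k, a) \<leftarrow> n_as. a = ev]. min 1 n)"
    by (induct n_as) (auto simp: min_def)
  then show ?thesis
    by (simp add: dim_gen_eigenspace[OF assms])
qed

lemma geometric_multiplicity_jordan_nf:
  assumes "jordan_nf A n_as"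
  shows "geometric_multiplicity A ev = length [(k, a) \<leftarrow> n_as. a = ev]"
  unfolding geometric_multiplicity_def
  using length_jordan_blocks[OF assms] length_jordan_blocks[OF someI[of "jordan_nf A", OF assms]]
  by simp

lemma geometric_multiplicity_eq_kernel_dim:
  assumes "A \<in> carrier_mat n n"
  shows "geometric_multiplicity A ev = kernel_dim (char_matrix A ev)"
proof -
  obtain n_as where jnf: "jordan_nf A n_as"
    using complex_jordan_nf_exists[OF assms] by blast
  have "char_matrix A ev \<in> carrier_mat n n"
    using assms by simp
  then have "char_matrix A ev ^\<^sub>m 1 = char_matrix A ev"
    by simp
  then show ?thesis
    by (simp only: geometric_multiplicity_jordan_nf[OF jnf] length_jordan_blocks[OF jnf]
        dim_gen_eigenspace_def)
qed

text \<open>A nonzero perturbation of a matrix of size 1 always moves its only eigenvalue, so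
  in dimension 1 a perturbation of rank exactly 1 cannot keep the spectrum.\<close>

lemma sp_rank_one_perturbation_dim_1:
  assumes A: "A \<in> carrier_mat 1 1" and B: "B \<in> carrier_mat 1 1"
    and rank: "vec_space.rank 1 B = 1"
  shows "sp (A + B) \<noteq> sp A"
proof
  have sp1: "sp C = {#C $$ (0, 0)#}" if "C \<in> carrier_mat 1 1" for C
  proof -
    have "upper_triangular C" using that by auto
    then have "char_poly C = [:- (C $$ (0, 0)), 1:]"
      using that by (simp add: char_poly_upper_triangular[OF that] diag_mat_def)
    then show ?thesis by (simp add: sp_def)
  qed
  assume "sp (A + B) = sp A"
  then have "B $$ (0, 0) = 0"
    using A B by (simp add: sp1)
  then have "B = 0\<^sub>m 1 1"
    using B by (intro eq_matI) auto
  moreover interpret vec_space "TYPE(complex)" 1 .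
  have "rank (0\<^sub>m 1 1) = 0"
  proof -
    have "det (0\<^sub>m 1 1 :: complex mat) = 0" by simp
    then have "rank (0\<^sub>m 1 1) < 1" using det_zero_low_rank[of "0\<^sub>m 1 1"] by simp
    then show ?thesis by simp
  qed
  ultimately show False
    using rank by simp
qed

end

theory Submission
  imports Defs
begin

text \<open>Each eigenspace is a line, so some \<open>u\<close> is orthogonal to no eigenvector of \<open>A\<close>. Let
  \<open>m 0, ..., m (n - 1)\<close> be the elements of \<open>M\<close> and put \<open>r 0 = u\<close> and
  \<open>r (j + 1) = (transpose A - m j) r j\<close>. These row vectors form an invertible matrix \<open>R\<close>, and
  \<open>R * A\<close> agrees with \<open>H * R\<close> outside the last row, where \<open>H\<close> is bidiagonal with diagonal \<open>m\<close>
  and superdiagonal 1. Hence \<open>inverse R * H * R\<close> has spectrum \<open>M\<close> and differs from \<open>A\<close> by a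
  matrix of rank at most 1. The difference can vanish only if \<open>M = sp A\<close>; in that case one
  perturbs the top right corner of a triangular form of \<open>A\<close>.\<close>

section \<open>One-dimensional kernels, avoidance of hyperplanes, rank 1 and roots of
  products\<close>

lemma kernel_dim_1D:
  assumes A: "A \<in> carrier_mat nr nc" and dim: "kernel_dim A = 1"
  obtains v where "v \<in> mat_kernel A" "\<And>w. w \<in> mat_kernel A \<Longrightarrow> \<exists>c. w = c \<cdot>\<^sub>v v"
proof -
  interpret kernel nr nc A by unfold_locales (rule A)
  obtain U where U: "finite U" "basis U" using kernel_basis_exists[OF A] by blast
  have "card U = 1" using Ker.dim_basis[OF U] dim by simp
  then obtain v where v: "U = {v}" by (auto simp: card_1_singleton_iff)
  have vk: "v \<in> mat_kernel A" and gen: "span {v} = mat_kernel A"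
    using U(2) v by (auto simp: Ker.basis_def)
  have "\<exists>c. w = c \<cdot>\<^sub>v v" if "w \<in> mat_kernel A" for w
  proof -
    have "w \<in> span {v}" using that gen by simp
    then obtain a where "w = lincomb a {v}"
      using Ker.finite_span[of "{v}"] vk by auto
    \<comment> \<open>A combination inside the kernel equals the same combination in the ambient
      space, where it is computed entrywise.\<close>
    also have "\<dots> = NC.lincomb a {v}" using vk lincomb_same[of "{v}" a] by simp
    also have "\<dots> = a v \<cdot>\<^sub>v v"
      using vk mat_kernel_carrier[OF A] NC.lincomb_index[of _ "{v}" a] NC.lincomb_dim[of "{v}" a]
      by (intro eq_vecI) auto
    finally show ?thesis by blast
  qed
  with vk show ?thesis by (rule that)
qed

text \<open>For \<open>u = (1, t, ..., t^(n-1))\<close> the scalar product with \<open>v\<close> is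
  a polynomial in \<open>t\<close> with the entries of \<open>v\<close> as coefficients. Finitely
  many nonzero polynomials leave some \<open>t\<close> that is a root of none.\<close>

lemma exists_vec_scalar_prod_nonzero:
  fixes S :: "'a :: field_char_0 vec set"
  assumes "finite S" "S \<subseteq> carrier_vec n" "0\<^sub>v n \<notin> S"
  obtains u where "u \<in> carrier_vec n" "\<And>v. v \<in> S \<Longrightarrow> u \<bullet> v \<noteq> 0"
proof -
  define p where "p v = (\<Sum>i<n. monom (v $ i) i)" for v :: "'a vec"
  have coeff: "coeff (p v) i = v $ i" if "i < n" for v i
    using that by (simp add: p_def coeff_sum)
  have "p v \<noteq> 0" if "v \<in> S" for v
  proof
    assume "p v = 0"
    then have "v = 0\<^sub>v n" using coeff[of _ v] that assms(2) by (intro eq_vecI) auto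
    with that assms(3) show False by simp
  qed
  then have "finite (\<Union>v\<in>S. {t. poly (p v) t = 0})"
    using assms(1) poly_roots_finite by blast
  then obtain t where t: "\<And>v. v \<in> S \<Longrightarrow> poly (p v) t \<noteq> 0"
    using ex_new_if_finite[OF infinite_UNIV_char_0] by blast
  show ?thesis
  proof
    show "vec n (\<lambda>i. t ^ i) \<in> carrier_vec n" by simp
    fix v assume v: "v \<in> S"
    have "vec n (\<lambda>i. t ^ i) \<bullet> v = poly (p v) t"
      using v assms(2) by (auto simp: p_def scalar_prod_def poly_sum poly_monom ac_simps lessThan_atLeast0 intro!: sum.cong)
    with t[OF v] show "vec n (\<lambda>i. t ^ i) \<bullet> v \<noteq> 0" by simp
  qed
qed

text \<open>The product form bounds the rank from above; a column with a nonzero entry is linearly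
  independent on its own and bounds it from below.\<close>

lemma rank_eq_1I:
  fixes B :: "'a :: field mat"
  assumes B: "B \<in> carrier_mat n nc" and "B \<noteq> 0\<^sub>m n nc"
    and prod: "\<And>r c. r < n \<Longrightarrow> c < nc \<Longrightarrow> B $$ (r, c) = f r * g c"
  shows "vec_space.rank n B = 1"
proof -
  interpret vec_space "TYPE('a)" n .
  have "rank B \<le> 1" using rank_le_1_product_entries[OF B, of f g] prod B by auto
  moreover have "rank B \<ge> 1"
  proof -
    obtain r c where rc: "r < n" "c < nc" "B $$ (r, c) \<noteq> 0"
      using assms(2) B by (metis carrier_matD eq_matI index_zero_mat)
    have "lin_indpt {col B c}"
    proof (rule finite_lin_indpt2)
      show sub: "{col B c} \<subseteq> carrier_vec n" using B by auto
      fix a assume "lincomb a {col B c} = 0\<^sub>v n"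
      then have "lincomb a {col B c} $ r = 0" using rc by simp
      then show "\<forall>v\<in>{col B c}. a v = 0" using rc B lincomb_index[OF rc(1) sub, of a] by simp
    qed simp
    moreover have "{col B c} \<subseteq> set (cols B)" using rc B by (auto simp: cols_def)
    ultimately have "card {col B c} \<le> rank B"
      using rank_ge_card_indpt[OF B] by blast
    then show ?thesis by simp
  qed
  ultimately show ?thesis by simp
qed

lemma proots_prod_list_linear:
  "proots (\<Prod>a\<leftarrow>as. [:- a, 1:]) = mset as" for as :: "'a :: idom list"
proof (induction as)
  case (Cons a as)
  have "(\<Prod>a\<leftarrow>as. [:- a, 1:]) \<noteq> 0" by (auto simp: prod_list_zero_iff)
  then have "proots ([:- a, 1:] * (\<Prod>a\<leftarrow>as. [:- a, 1:])) = {#a#} + mset as"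
    using Cons by (subst proots_mult) auto
  then show ?case by simp
qed simp

section \<open>Vectors orthogonal to a Krylov sequence\<close>

text \<open>Applying \<open>A - T $$ (k, k)\<close> to \<open>x\<close> removes the \<open>k\<close>-th coordinate from the support of
  \<open>Q *\<^sub>v x\<close> and preserves orthogonality to all but the last of the vectors \<open>r j\<close>. By induction
  the result is zero, so a nonzero \<open>x\<close> would be an eigenvector orthogonal to \<open>r 0\<close>.\<close>

lemma krylov_separating:
  fixes A :: "'a :: field mat"
  assumes A: "A \<in> carrier_mat n n" and wit: "similar_mat_wit A T P Q" and T: "upper_triangular T"
    and r: "\<And>j. r j \<in> carrier_vec n"
    and step: "\<And>j x. x \<in> carrier_vec n \<Longrightarrow> r j \<bullet> (A *\<^sub>v x) = m j * (r j \<bullet> x) + r (Suc j) \<bullet> x"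
    and eigen: "\<And>x ev. eigenvector A x ev \<Longrightarrow> r 0 \<bullet> x \<noteq> 0"
    and "k \<le> n" "x \<in> carrier_vec n"
    and "\<And>i. k \<le> i \<Longrightarrow> i < n \<Longrightarrow> (Q *\<^sub>v x) $ i = 0"
    and "\<And>j. j < k \<Longrightarrow> r j \<bullet> x = 0"
  shows "x = 0\<^sub>v n"
  using assms(7-10)
proof (induction k arbitrary: x)
  note wit' = similar_mat_witD2[OF A wit]
  case (0 x)
  have "Q *\<^sub>v x = 0\<^sub>v n" using 0 wit' by (intro eq_vecI) auto
  then have "(P * Q) *\<^sub>v x = P *\<^sub>v 0\<^sub>v n"
    using assoc_mult_mat_vec[OF wit'(6,7) 0(2)] by simp
  also have "P *\<^sub>v 0\<^sub>v n = 0\<^sub>v n" using wit'(6) by (intro eq_vecI) auto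
  finally show ?case using wit'(1) 0(2) by simp
next
  note wit' = similar_mat_witD2[OF A wit]
  case (Suc k x)
  have Tdim: "dim_row T = n" "dim_col T = n" using wit' by auto
  note x = \<open>x \<in> carrier_vec n\<close>
  define a where "a = T $$ (k, k)"
  define y where "y = A *\<^sub>v x - a \<cdot>\<^sub>v x"
  have y: "y \<in> carrier_vec n" using A x by (simp add: y_def)
  have QA: "Q * A = T * Q" 
  proof -
    have "Q * A = Q * (P * (T * Q))" using wit' assoc_mult_mat[of P n n T n Q n] by simp
    also have "\<dots> = (Q * P) * (T * Q)"
      using wit' by (intro assoc_mult_mat[symmetric, of _ n n _ n _ n]) auto
    also have "\<dots> = T * Q" using wit' left_mult_one_mat[of "T * Q" n n] by simp
    finally show ?thesis .
  qed
  define z where "z = Q *\<^sub>v x"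
  have z: "z \<in> carrier_vec n" using wit' x by (simp add: z_def)
  have Qy: "Q *\<^sub>v y = T *\<^sub>v z - a \<cdot>\<^sub>v z"
  proof -
    have "Q *\<^sub>v y = Q *\<^sub>v (A *\<^sub>v x) - Q *\<^sub>v (a \<cdot>\<^sub>v x)"
      unfolding y_def using wit'(7) x A by (intro mult_minus_distrib_mat_vec) auto
    also have "Q *\<^sub>v (A *\<^sub>v x) = (Q * A) *\<^sub>v x"
      using assoc_mult_mat_vec[OF wit'(7) A x] by simp
    also have "\<dots> = T *\<^sub>v z" unfolding QA z_def using wit' x by simp
    also have "Q *\<^sub>v (a \<cdot>\<^sub>v x) = a \<cdot>\<^sub>v z" unfolding z_def using wit' x by (simp add: mult_mat_vec)
    finally show ?thesis .
  qed
  have "y = 0\<^sub>v n"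
  proof (rule Suc.IH)
    show "k \<le> n" using Suc by simp
    show "y \<in> carrier_vec n" by fact
    fix i assume i: "k \<le> i" "i < n"
    have "(T *\<^sub>v z) $ i = (\<Sum>j<n. T $$ (i, j) * z $ j)"
      using i Tdim z by (simp add: scalar_prod_def lessThan_atLeast0)
    \<comment> \<open>Only column \<open>k\<close> contributes: \<open>z\<close> vanishes beyond
      \<open>k\<close> by hypothesis, and for \<open>j < k\<close> the entry lies below the diagonal
      of \<open>T\<close>.\<close>
    also have "\<dots> = (\<Sum>j<n. if j = k then T $$ (i, k) * z $ k else 0)"
    proof (rule sum.cong)
      fix j assume "j \<in> {..<n}"
      then have "j < n" by simp
      consider "j = k" | "k < j" | "j < k" by linarith
      then show "T $$ (i, j) * z $ j = (if j = k then T $$ (i, k) * z $ k else 0)"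
      proof cases
        case 2
        then show ?thesis using Suc.prems(3)[of j] \<open>j < n\<close> by (simp add: z_def)
      next
        case 3
        then show ?thesis using upper_triangularD[OF T, of j i] i Tdim by simp
      qed simp
    qed simp
    also have "\<dots> = T $$ (i, k) * z $ k" using Suc.prems(1) by simp
    also have "\<dots> = a * z $ i"
    proof (cases "i = k")
      case False
      then show ?thesis using upper_triangularD[OF T, of k i] i Tdim Suc.prems(3)[of i] by (simp add: z_def)
    qed (simp add: a_def)
    finally show "(Q *\<^sub>v y) $ i = 0" unfolding Qy using i z Tdim by simp
  next
    fix j assume j: "j < k"
    have "r j \<bullet> y = r j \<bullet> (A *\<^sub>v x) - r j \<bullet> (a \<cdot>\<^sub>v x)"
      unfolding y_def using A x r by (intro scalar_prod_minus_distrib) auto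
    \<comment> \<open>By \<open>step\<close> the product involves \<open>r j\<close> and
      \<open>r (Suc j)\<close>; both are orthogonal to \<open>x\<close> because
      \<open>Suc j < Suc k\<close>.\<close>
    also have "\<dots> = 0"
      using step[OF x, of j] Suc.prems(4)[of j] Suc.prems(4)[of "Suc j"] j r[of j] x by simp
    finally show "r j \<bullet> y = 0" .
  qed
  have "A *\<^sub>v x = a \<cdot>\<^sub>v x"
  proof (rule eq_vecI)
    fix i assume "i < dim_vec (a \<cdot>\<^sub>v x)"
    then have i: "i < n" using x by simp
    have "y $ i = (0\<^sub>v n) $ i" using \<open>y = 0\<^sub>v n\<close> by simp
    then show "(A *\<^sub>v x) $ i = (a \<cdot>\<^sub>v x) $ i" unfolding y_def using i x A by simp
  qed (use A x in simp)
  then have "x \<noteq> 0\<^sub>v n \<Longrightarrow> eigenvector A x a"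
    using A x by (simp add: eigenvector_def)
  then show ?case using eigen Suc.prems(4)[of 0] by blast
qed

section \<open>A vector orthogonal to no eigenvector\<close>

text \<open>Here the hypothesis on geometric multiplicities enters: an eigenspace of dimension at
  least 2 would contain a nonzero vector orthogonal to \<open>u\<close>.\<close>

lemma exists_separating_eigenvectors:
  fixes A :: "complex mat"
  assumes A: "A \<in> carrier_mat n n"
    and geo: "\<And>ev. eigenvalue A ev \<Longrightarrow> geometric_multiplicity A ev = 1"
  obtains u where "u \<in> carrier_vec n" "\<And>x ev. eigenvector A x ev \<Longrightarrow> u \<bullet> x \<noteq> 0"
proof -
  have "\<exists>v. v \<in> carrier_vec n \<and> (\<forall>x. eigenvector A x ev \<longrightarrow> (\<exists>c. x = c \<cdot>\<^sub>v v))"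
    if "eigenvalue A ev" for ev
  proof -
    have C: "char_matrix A ev \<in> carrier_mat n n" using A by simp
    have "kernel_dim (char_matrix A ev) = 1"
      using geo[OF that] geometric_multiplicity_eq_kernel_dim[OF A] by simp
    then obtain v where v: "v \<in> mat_kernel (char_matrix A ev)"
      and span: "\<And>w. w \<in> mat_kernel (char_matrix A ev) \<Longrightarrow> \<exists>c. w = c \<cdot>\<^sub>v v"
      using kernel_dim_1D[OF C] by blast
    have "\<exists>c. x = c \<cdot>\<^sub>v v" if "eigenvector A x ev" for x
      using that span mat_kernelI[OF C] eigenvector_char_matrix[OF A] by blast
    with mat_kernelD(1)[OF C v] show ?thesis by blast
  qed
  then obtain e where e: "\<And>ev. eigenvalue A ev \<Longrightarrow> e ev \<in> carrier_vec n"
    and span: "\<And>ev x. eigenvalue A ev \<Longrightarrow> eigenvector A x ev \<Longrightarrow> \<exists>c. x = c \<cdot>\<^sub>v e ev"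
    by metis
  \<comment> \<open>Nothing is known about \<open>e ev\<close> being nonzero, so zero is removed by
    hand. No eigenvalue is lost, since a vector with an eigenvector as multiple is nonzero.\<close>
  define S where "S = e ` {ev. eigenvalue A ev} - {0\<^sub>v n}"
  have "finite S"
    using set_mset_sp[OF A] by (metis S_def finite_Diff finite_imageI finite_set_mset)
  moreover have "S \<subseteq> carrier_vec n" "0\<^sub>v n \<notin> S" using e by (auto simp: S_def)
  ultimately obtain u where u: "u \<in> carrier_vec n" "\<And>v. v \<in> S \<Longrightarrow> u \<bullet> v \<noteq> 0"
    using exists_vec_scalar_prod_nonzero by blast
  have "u \<bullet> x \<noteq> 0" if x: "eigenvector A x ev" for x ev
  proof -
    have ev: "eigenvalue A ev" using x by (auto simp: eigenvalue_def)
    then obtain c where c: "x = c \<cdot>\<^sub>v e ev" using span x by blast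
    have "x \<noteq> 0\<^sub>v n" using x A by (simp add: eigenvector_def)
    then have "c \<noteq> 0" "e ev \<noteq> 0\<^sub>v n" using c e[OF ev] by auto
    then have "u \<bullet> e ev \<noteq> 0" using u(2)[of "e ev"] ev by (simp add: S_def)
    then show ?thesis using c \<open>c \<noteq> 0\<close> u(1) e[OF ev] by simp
  qed
  with u(1) show ?thesis by (rule that)
qed

section \<open>Prescribing the spectrum\<close>

text \<open>These are the rows \<open>u^T (A - m 0) ... (A - m (j - 1))\<close>, kept as column
  vectors by means of the transpose. The shifts will be the prescribed eigenvalues.\<close>

fun shifted_krylov :: "'a :: comm_ring_1 mat \<Rightarrow> (nat \<Rightarrow> 'a) \<Rightarrow> 'a vec \<Rightarrow> nat \<Rightarrow> 'a vec" where
  "shifted_krylov A m u 0 = u"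
| "shifted_krylov A m u (Suc j) =
     transpose_mat A *\<^sub>v shifted_krylov A m u j - m j \<cdot>\<^sub>v shifted_krylov A m u j"

lemma shifted_krylov_carrier:
  assumes "A \<in> carrier_mat n n" "u \<in> carrier_vec n"
  shows "shifted_krylov A m u j \<in> carrier_vec n"
  using assms by (induction j) auto

lemma shifted_krylov_mult:
  assumes A: "A \<in> carrier_mat n n" and u: "u \<in> carrier_vec n" and x: "x \<in> carrier_vec n"
  shows "shifted_krylov A m u j \<bullet> (A *\<^sub>v x) =
    m j * (shifted_krylov A m u j \<bullet> x) + shifted_krylov A m u (Suc j) \<bullet> x"
proof -
  note r = shifted_krylov_carrier[OF A u, of m j]
  have "shifted_krylov A m u (Suc j) \<bullet> x =
      (transpose_mat A *\<^sub>v shifted_krylov A m u j) \<bullet> x - (m j \<cdot>\<^sub>v shifted_krylov A m u j) \<bullet> x"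
    using A r x by (simp add: minus_scalar_prod_distrib[of _ n])
  also have "(transpose_mat A *\<^sub>v shifted_krylov A m u j) \<bullet> x = shifted_krylov A m u j \<bullet> (A *\<^sub>v x)"
    using transpose_vec_mult_scalar[OF A x r] by simp
  finally show ?thesis using r x by simp
qed

text \<open>The conclusion is about entries instead of the rank because \<open>B\<close> may be zero
  when \<open>mset ms\<close> is already the spectrum of \<open>A\<close>.\<close>

lemma exists_outer_product_perturbation:
  fixes A :: "complex mat"
  assumes A: "A \<in> carrier_mat n n"
    and geo: "\<And>ev. eigenvalue A ev \<Longrightarrow> geometric_multiplicity A ev = 1"
    and ms: "length ms = n"
  obtains B f g where "B \<in> carrier_mat n n" "sp (A + B) = mset ms"
    "\<And>r c. r < n \<Longrightarrow> c < n \<Longrightarrow> B $$ (r, c) = f r * g c"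
proof -
  obtain u where u: "u \<in> carrier_vec n" "\<And>x ev. eigenvector A x ev \<Longrightarrow> u \<bullet> x \<noteq> 0"
    using exists_separating_eigenvectors[OF A geo] by blast
  define m where "m j = ms ! j" for j
  define r where "r = shifted_krylov A m u"
  have r: "r j \<in> carrier_vec n" for j
    unfolding r_def using shifted_krylov_carrier[OF A u(1)] .
  have step: "r j \<bullet> (A *\<^sub>v x) = m j * (r j \<bullet> x) + r (Suc j) \<bullet> x" if "x \<in> carrier_vec n" for j x
    unfolding r_def using shifted_krylov_mult[OF A u(1) that] .
  obtain as where "char_poly A = (\<Prod>a\<leftarrow>as. [:- a, 1:])" using char_poly_factorized[OF A] by blast
  \<comment> \<open>The triangular form only serves the induction in
    \<open>krylov_separating\<close>; its diagonal need not be related to \<open>ms\<close>.\<close>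
  then obtain T P Q where wit: "similar_mat_wit A T P Q" and T: "upper_triangular T"
    using schur_decomposition[OF A, of as] by (metis prod_cases3)
  \<comment> \<open>For \<open>k = n\<close> the condition on the coordinates of
    \<open>Q *\<^sub>v x\<close> is vacuous.\<close>
  have sep: "x = 0\<^sub>v n" if "x \<in> carrier_vec n" "\<And>j. j < n \<Longrightarrow> r j \<bullet> x = 0" for x
    by (rule krylov_separating[where r = r and m = m and k = n, OF A wit T r step])
      (use u(2) that in \<open>auto simp: r_def\<close>)
  define R where "R = mat n n (\<lambda>(i, j). r i $ j)"
  have R: "R \<in> carrier_mat n n" by (simp add: R_def)
  have row_R: "row R i = r i" if "i < n" for i
    using that r[of i] by (intro eq_vecI) (auto simp: R_def)
  have "det R \<noteq> 0"
  proof
    assume "det R = 0"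
    then obtain x where x: "x \<in> carrier_vec n" "x \<noteq> 0\<^sub>v n" "R *\<^sub>v x = 0\<^sub>v n"
      using det_0_iff_vec_prod_zero_field[OF R] by blast
    have "r j \<bullet> x = 0" if "j < n" for j
    proof -
      have "(R *\<^sub>v x) $ j = r j \<bullet> x" using that R row_R by simp
      then show ?thesis using x(3) that by simp
    qed
    with sep x show False by blast
  qed
  from det_non_zero_imp_unit[OF R this, of "()"]
  obtain S where S: "S \<in> carrier_mat n n" and SR: "S * R = 1\<^sub>m n" and RS: "R * S = 1\<^sub>m n"
    by (auto simp: Units_def ring_mat_def)
  define H where "H = mat n n (\<lambda>(i, j). if i = j then m i else if j = Suc i then 1 else 0)"
  have H: "H \<in> carrier_mat n n" by (simp add: H_def)
  define D where "D = H * R - R * A"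
  have D: "D \<in> carrier_mat n n" unfolding D_def using R A by (intro minus_carrier_mat mult_carrier_mat)
  \<comment> \<open>Row \<open>i\<close> of \<open>R * A\<close> is \<open>m i\<close> times
    \<open>r i\<close> plus \<open>r (Suc i)\<close>, which is row \<open>i\<close> of
    \<open>H * R\<close> as long as \<open>R\<close> has a row \<open>Suc i\<close>. Only the last
    row fails, as \<open>r n\<close> is not a row of \<open>R\<close>.\<close>
  have D0: "D $$ (i, c) = 0" if "Suc i < n" "c < n" for i c
  proof -
    have "A *\<^sub>v unit_vec n c = col A c" using that A by (intro eq_vecI) auto
    then have "(R * A) $$ (i, c) = r i \<bullet> (A *\<^sub>v unit_vec n c)"
      using that R A row_R by simp
    also have "\<dots> = m i * r i $ c + r (Suc i) $ c"
      using that step[of "unit_vec n c" i] r[of i] r[of "Suc i"] by simp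
    also have "\<dots> = (\<Sum>j<n. (if j = i then m i * r i $ c else 0) + (if j = Suc i then r (Suc i) $ c else 0))"
      using that by (simp add: sum.distrib)
    also have "\<dots> = (\<Sum>j<n. H $$ (i, j) * R $$ (j, c))"
      using that by (intro sum.cong) (auto simp: H_def R_def)
    also have "\<dots> = (H * R) $$ (i, c)"
      using that H R by (simp add: scalar_prod_def lessThan_atLeast0)
    finally show ?thesis using that H R A by (simp add: D_def)
  qed
  \<comment> \<open>Since \<open>S\<close> is the inverse of \<open>R\<close>, this choice gives
    \<open>A + B = S * H * R\<close>.\<close>
  define B where "B = S * D"
  show ?thesis
  proof
    show B: "B \<in> carrier_mat n n" using S D by (simp add: B_def)
    \<comment> \<open>Only the last row of \<open>D\<close> survives, so \<open>B\<close> is the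
      last column of \<open>S\<close> times that row.\<close>
    show "B $$ (i, c) = S $$ (i, n - 1) * D $$ (n - 1, c)" if "i < n" "c < n" for i c
    proof -
      have "B $$ (i, c) = (\<Sum>j<n. S $$ (i, j) * D $$ (j, c))"
        using that S D by (simp add: B_def scalar_prod_def lessThan_atLeast0)
      also have "\<dots> = (\<Sum>j\<in>{n - 1}. S $$ (i, j) * D $$ (j, c))"
        using that D0 by (intro sum.mono_neutral_right) auto
      finally show ?thesis by simp
    qed
    have "S * (R * A) = A" using assoc_mult_mat[OF S R A] SR A by simp
    then have "B = S * (H * R) - A"
      unfolding B_def D_def
      using mult_minus_distrib_mat[OF S mult_carrier_mat[OF H R] mult_carrier_mat[OF R A]] by simp
    then have "A + B = S * H * R" using S R A H assoc_mult_mat[OF S H R] by (intro eq_matI) auto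
    then have "similar_mat (A + B) H"
      using S R H A B SR RS by (intro similar_matI[of _ _ S R n]) auto
    then have "char_poly (A + B) = char_poly H" by (rule char_poly_similar)
    also have "\<dots> = (\<Prod>a\<leftarrow>diag_mat H. [:- a, 1:])"
      by (rule char_poly_upper_triangular[OF H]) (auto simp: H_def)
    also have "diag_mat H = ms"
      by (rule nth_equalityI) (auto simp: diag_mat_def H_def m_def ms)
    finally show "sp (A + B) = mset ms" by (simp add: sp_def proots_prod_list_linear)
  qed
qed

section \<open>Keeping the spectrum, and the combination of both cases\<close>

text \<open>For \<open>n \<ge> 2\<close> the top right corner lies strictly above the diagonal, so
  changing it in \<open>T\<close> preserves the eigenvalues.\<close>

lemma exists_isospectral_rank_1_perturbation:
  fixes A :: "complex mat"
  assumes A: "A \<in> carrier_mat n n" and n: "n \<ge> 2"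
  obtains B where "B \<in> carrier_mat n n" "vec_space.rank n B = 1" "sp (A + B) = sp A"
proof -
  obtain as where "char_poly A = (\<Prod>a\<leftarrow>as. [:- a, 1:])" using char_poly_factorized[OF A] by blast
  then obtain T P Q where wit: "similar_mat_wit A T P Q" and T: "upper_triangular T"
    using schur_decomposition[OF A, of as] by (metis prod_cases3)
  note wit' = similar_mat_witD2[OF A wit]
  define E where "E = mat n n (\<lambda>(i, j). if i = 0 \<and> j = n - 1 then 1 else 0 :: complex)"
  have E: "E \<in> carrier_mat n n" by (simp add: E_def)
  define F where "F = P * E"
  have F_carrier: "F \<in> carrier_mat n n" using wit' E by (simp add: F_def)
  define B where "B = F * Q"
  have B: "B \<in> carrier_mat n n" using wit' E by (simp add: B_def F_def)
  have "B $$ (i, j) = P $$ (i, 0) * Q $$ (n - 1, j)" if "i < n" "j < n" for i j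
  proof -
    have F: "F $$ (i, l) = (if l = n - 1 then P $$ (i, 0) else 0)" if "l < n" for l
    proof -
      have "F $$ (i, l) = (\<Sum>k<n. P $$ (i, k) * E $$ (k, l))"
        using that \<open>i < n\<close> wit' E by (simp add: F_def scalar_prod_def lessThan_atLeast0)
      also have "\<dots> = (\<Sum>k\<in>{0}. P $$ (i, k) * E $$ (k, l))"
        using n that by (intro sum.mono_neutral_right) (auto simp: E_def)
      finally show ?thesis using n that by (auto simp: E_def)
    qed
    have "B $$ (i, j) = (\<Sum>l<n. F $$ (i, l) * Q $$ (l, j))"
      using that wit'(6,7) E F_carrier by (simp add: B_def scalar_prod_def lessThan_atLeast0)
    also have "\<dots> = (\<Sum>l\<in>{n - 1}. F $$ (i, l) * Q $$ (l, j))"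
      using n F by (intro sum.mono_neutral_right) auto
    finally show ?thesis using F n by simp
  qed
  moreover have "B \<noteq> 0\<^sub>m n n"
  proof
    assume "B = 0\<^sub>m n n"
    \<comment> \<open>Undoing the conjugation turns \<open>B\<close> back into \<open>E\<close>,
      whose corner is 1.\<close>
    then have "Q * B * P = 0\<^sub>m n n" using wit' by simp
    moreover have "Q * B * P = (Q * P) * E * (Q * P)"
      using wit'(4-7) E by (simp add: B_def F_def assoc_mult_mat[of _ n n _ n _ n])
    ultimately have "E = 0\<^sub>m n n" using wit'(2) E by simp
    then have "E $$ (0, n - 1) = 0" using n by simp
    then show False using n by (simp add: E_def)
  qed
  ultimately have "vec_space.rank n B = 1" by (intro rank_eq_1I[OF B])
  moreover have "sp (A + B) = sp A"
  proof -
    have TE: "T + E \<in> carrier_mat n n" using wit' E by simp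
    have "A + B = P * (T + E) * Q"
      using wit'(3-7) E
      by (simp add: B_def F_def mult_add_distrib_mat[of P n n] add_mult_distrib_mat[of _ n n])
    then have "similar_mat (A + B) (T + E)"
      using wit' A B TE by (intro similar_matI[of _ _ P Q n]) auto
    then have "char_poly (A + B) = char_poly (T + E)" by (rule char_poly_similar)
    also have "\<dots> = (\<Prod>a\<leftarrow>diag_mat (T + E). [:- a, 1:])"
      using TE T wit' E upper_triangularD[OF T]
      by (intro char_poly_upper_triangular) (auto simp: E_def)
    also have "diag_mat (T + E) = diag_mat T"
      using wit' n by (intro nth_equalityI) (auto simp: diag_mat_def E_def)
    also have "(\<Prod>a\<leftarrow>diag_mat T. [:- a, 1:]) = char_poly T"
      using char_poly_upper_triangular[OF wit'(5) T] by simp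
    also have "\<dots> = char_poly A"
      using char_poly_similar[of A T] wit unfolding similar_mat_def by metis
    finally show ?thesis by (simp add: sp_def)
  qed
  ultimately show ?thesis using B by (intro that)
qed

text \<open>For \<open>n = 0\<close> no matrix has rank 1, and for \<open>n = 1\<close> a rank 1
  perturbation always moves the eigenvalue, by \<open>sp_rank_one_perturbation_dim_1\<close>; the
  assumptions on \<open>n\<close> exclude exactly these failures.\<close>

theorem corollary1:
  fixes A :: "complex mat" and n :: nat and M :: "complex multiset"
  assumes "A \<in> carrier_mat n n"
    and "n \<ge> 1"
    and "\<And>ev. eigenvalue A ev \<Longrightarrow> geometric_multiplicity A ev = 1"
    and "size M = n"
    and "n = 1 \<Longrightarrow> M \<noteq> sp A"
  shows "\<exists>B \<in> carrier_mat n n. vec_space.rank n B = 1 \<and> sp (A + B) = M"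
proof (cases "M = sp A")
  case True
  then have "n \<ge> 2" using assms(2,5) by fastforce
  then show ?thesis using exists_isospectral_rank_1_perturbation[OF assms(1)] True by metis
next
  case False
  obtain ms where ms: "M = mset ms" by (metis ex_mset)
  then have "length ms = n" using assms(4) by simp
  then obtain B f g where B: "B \<in> carrier_mat n n" "sp (A + B) = mset ms"
    and prod: "\<And>r c. r < n \<Longrightarrow> c < n \<Longrightarrow> B $$ (r, c) = f r * g c"
    using exists_outer_product_perturbation[OF assms(1,3)] by metis
  have "B \<noteq> 0\<^sub>m n n" using B False ms assms(1) by auto
  then have "vec_space.rank n B = 1" using rank_eq_1I[OF B(1) _ prod] by blast
  with B ms show ?thesis by blast
qed

end
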